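(* For an integer base $b \ge 2$ let $X = b^Y$ for some random variable $Y \sim \mathcal{N}(\mu,\sigma^2)$ with $\mu \in \mathbb{R}$ and $\sigma \ge 1/6$. Then the leading base-$b$ digits $D_0, D_1, D_2, \ldots$ of $X$ satisfy the following inequalities: for arbitrary digits $d_0, d_1, d_2, \ldots \in \{0,1,\ldots,b-1\}$ with $d_0 \ge 1$ and integers $\ell \ge 0$, $$\left| \frac{\mathbb{P}\bigl( (D_i)_{i=0}^\ell = (d_i)_{i=0}^\ell \bigr)}{\log_b(1 + b^{-\ell}/\boldsymbol{d}_{(\ell)})} - 1 \right| \le 3 \cdot h\bigl( \lfloor 36\sigma^2 \rfloor \bigr),$$ where $\boldsymbol{d}_{(\ell)} := \sum_{i=0}^\ell d_i \cdot b^{-i}$ and $h(m) := \sqrt{m!/m^m}$ for integers $m \ge 1$.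
   Context: For a random variable $X > 0$ and an integer base $b \ge 2$, write $X = M \cdot b^Z$ with an integer $Z$ and mantissa $M \in [1,b)$. The leading digits $D_i \in \{0,1,\ldots,b-1\}$ of $X$ are defined by $M = \sum_{i=0}^\infty D_i \cdot b^{-i}$, where one requires $D_i \ne b-1$ for infinitely many $i$; this makes the expansion unique and entails $D_0 \ge 1$. *)

theory Defs
  imports "HOL-Probability.Probability"
begin

text \<open>For \<open>x > 0\<close> and \<open>b \<ge> 2\<close> both descriptions below determine a unique object; outside this
  range the values are unspecified.\<close>

definition base_mantissa :: "nat \<Rightarrow> real \<Rightarrow> real" where
  "base_mantissa b x =
     (THE m. 1 \<le> m \<and> m < real b \<and> (\<exists>z::int. x = m * real b powi z))"

definition leading_digits :: "nat \<Rightarrow> real \<Rightarrow> nat \<Rightarrow> nat" where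
  "leading_digits b x =
     (THE D. (\<forall>i. D i \<in> {0..b - 1}) \<and> infinite {i. D i \<noteq> b - 1} \<and>
             (\<lambda>i. real (D i) * real b powi (- int i)) sums base_mantissa b x)"

definition digit_value :: "nat \<Rightarrow> (nat \<Rightarrow> nat) \<Rightarrow> nat \<Rightarrow> real" where
  "digit_value b d l = (\<Sum>i=0..l. real (d i) * real b powi (- int i))"

definition h :: "nat \<Rightarrow> real" where
  "h m = sqrt (fact m / real m ^ m)"

end

theory Submission
  imports Defs
begin

text \<open>The first digits of \<open>b powr Y\<close> are prescribed exactly when \<open>frac Y\<close> lies in an interval
  \<open>[a, c)\<close> with \<open>c - a\<close> the Benford probability, and the indicator of that event is
  \<open>(c - a) + frac (Y - c) - frac (Y - a)\<close>. Expanding the two sawtooth terms in Fourier series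
  (through the imaginary part of \<open>- Ln (1 - z)\<close> on the unit circle) and taking expectations turns
  the deviation into a series whose \<open>k\<close>-th term is at most \<open>2 (c - a) \<bar>\<phi> (2 \<pi> k)\<bar>\<close>, where \<open>\<phi>\<close> is the
  characteristic function of \<open>Y\<close>. For a normal variable the series is at most
  \<open>3 (c - a) exp (- 18 \<sigma>\<^sup>2)\<close>, and \<open>m ^ m / m! \<le> exp m\<close> compares it with \<open>h\<close>.\<close>

section \<open>Fourier series of the sawtooth function and characteristic functions\<close>

text \<open>With \<open>t = pi * frac x\<close>, the number \<open>1 - iexp (2 * t)\<close> factors
  as \<open>2 * sin t * iexp (t - pi / 2)\<close>. Since \<open>0 < t < pi\<close>, the modulus is
  positive and the angle lies in the principal branch.\<close>

lemma Im_Ln_one_minus_iexp: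
  assumes "x \<notin> \<int>"
  shows "Im (Ln (1 - iexp (2 * pi * x))) = pi * (frac x - 1 / 2)"
proof -
  define t where "t = pi * frac x"
  have "0 < frac x"
    using assms frac_ge_0[of x] frac_eq_0_iff[of x] by linarith
  then have t: "0 < t" "t < pi"
    using frac_lt_1[of x] by (auto simp: t_def)
  have "2 * pi * x = 2 * t + 2 * pi * real_of_int \<lfloor>x\<rfloor>"
    by (simp add: t_def frac_def algebra_simps)
  then have "cos (2 * pi * x) = cos (2 * t)" "sin (2 * pi * x) = sin (2 * t)"
    by (simp_all only: cos_add sin_add sin_int_2pin cos_int_2pin)
  then have periodic: "iexp (2 * pi * x) = iexp (2 * t)"
    by (simp add: complex_eq_iff Re_exp Im_exp del: of_real_mult)
  have "Ln (1 - iexp (2 * pi * x)) = Complex (ln (2 * sin t)) (t - pi / 2)"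
  proof (rule Ln_unique)
    show "exp (Complex (ln (2 * sin t)) (t - pi / 2)) = 1 - iexp (2 * pi * x)"
      unfolding periodic using sin_gt_zero[OF t]
      by (simp add: complex_eq_iff Re_exp Im_exp sin_diff cos_diff cos_double_sin sin_double
          power2_eq_square del: of_real_mult)
  qed (use t in auto)
  then show ?thesis by (simp add: t_def algebra_simps)
qed

lemma minus_Ln_one_minus_sums:
  fixes z :: complex
  assumes "norm z < 1"
  shows "(\<lambda>k. z ^ Suc k / of_nat (Suc k)) sums - Ln (1 - z)"
proof -
  have "(\<lambda>n. z ^ n / of_nat n) sums - Ln (1 - z)"
    using sums_minus[OF Ln_series'[of "- z"]] assms by simp
  \<comment> \<open>The index shift loses nothing: the term at \<open>n = 0\<close> is
    \<open>1 / 0\<close>, which is 0.\<close>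
  then show ?thesis by (subst sums_Suc_iff) simp
qed

text \<open>A chord of the unit circle is no longer than its arc. Applied to the phases at
  \<open>a\<close> and \<open>c\<close>, this yields a factor that cancels the \<open>1 / k\<close>
  of the Fourier coefficients and leaves \<open>\<bar>c - a\<bar>\<close>.\<close>

lemma norm_iexp_diff_le: "norm (iexp s - iexp t) \<le> \<bar>s - t\<bar>"
proof -
  have "iexp s - iexp t = iexp t * (iexp (s - t) - 1)"
    by (simp add: algebra_simps flip: exp_add)
  then have "norm (iexp s - iexp t) = 2 * \<bar>sin ((s - t) / 2)\<bar>"
    using dist_exp_i_1[of "s - t"] by (simp add: norm_mult del: of_real_diff)
  then show ?thesis using abs_sin_x_le_abs_x[of "(s - t) / 2"] by simp
qed

text \<open>The logarithm is expanded in powers of the exponential, and each power has as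
  expectation a phase times a value of the characteristic function. Damping by \<open>r < 1\<close>
  permits the exchange of sum and expectation.\<close>

lemma (in prob_space) expectation_Ln_one_minus_iexp_sums:
  assumes Y[measurable]: "Y \<in> borel_measurable M" and r: "0 \<le> r" "r < 1"
  shows "(\<lambda>k. complex_of_real (r ^ Suc k / real (Suc k)) * iexp (- (2 * pi * real (Suc k) * a))
            * char (distr M borel Y) (2 * pi * real (Suc k)))
         sums - expectation (\<lambda>\<omega>. Ln (1 - r * iexp (2 * pi * (Y \<omega> - a))))"
proof -
  define f where "f k \<omega> = (r * iexp (2 * pi * (Y \<omega> - a))) ^ Suc k / of_nat (Suc k)" for k \<omega>
  have [measurable]: "f k \<in> borel_measurable M" for k
    unfolding f_def by measurable
  have norm_f: "norm (f k \<omega>) = r ^ Suc k / Suc k" for k \<omega>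
    using r by (simp add: f_def norm_divide norm_mult norm_power del: of_real_mult of_real_diff of_nat_Suc power_Suc)
  have int_f: "integrable M (f k)" for k
    by (rule integrable_const_bound[where B = "r ^ Suc k / Suc k"]) (auto simp: norm_f)
  have "summable (\<lambda>k. r ^ Suc k / real (Suc k))"
  proof (rule summable_comparison_test')
    show "summable (\<lambda>k. r ^ Suc k)"
      using r by (auto intro!: summable_mult summable_geometric)
    show "norm (r ^ Suc k / real (Suc k)) \<le> r ^ Suc k" if "0 \<le> k" for k
      using r divide_left_mono[of 1 "real (Suc k)" "r ^ Suc k"] by simp
  qed
  \<comment> \<open>The norm of \<open>f k\<close> is constant in \<open>\<omega>\<close>, so one
    numerical series settles both summability conditions of the exchange.\<close>
  then have "(\<lambda>k. expectation (f k)) sums expectation (\<lambda>\<omega>. \<Sum>k. f k \<omega>)"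
    by (intro sums_integral int_f) (auto simp: norm_f prob_space)
  moreover have "(\<Sum>k. f k \<omega>) = - Ln (1 - r * iexp (2 * pi * (Y \<omega> - a)))" for \<omega>
    unfolding f_def using r
    by (intro sums_unique[symmetric] minus_Ln_one_minus_sums)
       (simp add: norm_mult del: of_real_mult of_real_diff)
  moreover have "expectation (f k) = complex_of_real (r ^ Suc k / real (Suc k))
      * iexp (- (2 * pi * real (Suc k) * a)) * char (distr M borel Y) (2 * pi * real (Suc k))" for k
  proof -
    have "f k = (\<lambda>\<omega>. complex_of_real (r ^ Suc k / real (Suc k))
      * iexp (- (2 * pi * real (Suc k) * a)) * iexp (2 * pi * real (Suc k) * Y \<omega>))"
      unfolding f_def power_mult_distrib exp_of_nat_mult[symmetric]
      by (auto simp: fun_eq_iff algebra_simps simp flip: exp_add)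
    then show ?thesis
      by (simp add: char_def integral_distr del: of_real_mult of_nat_Suc)
  qed
  ultimately show ?thesis by simp
qed

text \<open>Abel summation of the Fourier series of the sawtooth function: the damping parameter
  \<open>r < 1\<close> makes the series converge absolutely, and \<open>Im Ln\<close> stays bounded as \<open>r\<close> tends to 1.\<close>

lemma (in prob_space) expectation_frac_diff_le:
  assumes Y[measurable]: "Y \<in> borel_measurable M"
    and a: "AE \<omega> in M. Y \<omega> - a \<notin> \<int>" and c: "AE \<omega> in M. Y \<omega> - c \<notin> \<int>"
    and B: "summable B" "\<And>k. norm (char (distr M borel Y) (2 * pi * real (Suc k))) \<le> B k"
  shows "\<bar>expectation (\<lambda>\<omega>. frac (Y \<omega> - c) - frac (Y \<omega> - a))\<bar> \<le> 2 * \<bar>c - a\<bar> * (\<Sum>k. B k)"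
proof -
  define G where "G u r \<omega> = Ln (1 - complex_of_real r * iexp (2 * pi * (Y \<omega> - u)))" for u r \<omega>
  \<comment> \<open>For \<open>r < 1\<close> the argument of \<open>Ln\<close> stays in the open
    right half plane, away from the branch cut.\<close>
  have Re_pos: "0 < Re (1 - complex_of_real r * iexp x)" if "0 \<le> r" "r < 1" for r x
  proof -
    have "r * cos x \<le> r * 1" using that by (intro mult_left_mono) auto
    then show ?thesis using that by (simp add: Re_exp)
  qed
  have meas: "G u r \<in> borel_measurable M" if "0 \<le> r" "r < 1" for u r
  proof -
    have "continuous_on UNIV (\<lambda>y. Ln (1 - complex_of_real r * iexp (2 * pi * (y - u))))"
    proof (intro continuous_intros)
      show "1 - complex_of_real r * iexp (2 * pi * (y - u)) \<notin> \<real>\<^sub>\<le>\<^sub>0" for y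
        using Re_pos[OF that, of "2 * pi * (y - u)"] unfolding complex_nonpos_Reals_iff by linarith
    qed
    from borel_measurable_continuous_onI[OF this] show ?thesis
      unfolding G_def by (rule measurable_compose[OF Y])
  qed
  \<comment> \<open>This bound blows up as \<open>r\<close> tends to 1 and serves only for
    integrability at fixed \<open>r\<close>; the limit uses a bound on the imaginary part.\<close>
  have norm_G: "norm (G u r \<omega>) \<le> (\<Sum>k. r ^ Suc k)" if "0 \<le> r" "r < 1" for u r \<omega>
  proof -
    let ?z = "r * iexp (2 * pi * (Y \<omega> - u))"
    have norm_z: "norm ?z = r"
      using that by (simp add: norm_mult del: of_real_mult of_real_diff)
    have "norm (?z ^ Suc k / of_nat (Suc k)) \<le> r ^ Suc k" for k
    proof -
      have "norm (?z ^ Suc k / of_nat (Suc k)) = r ^ Suc k / real (Suc k)"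
        by (simp only: norm_divide norm_power norm_z norm_of_nat)
      also have "\<dots> \<le> r ^ Suc k / 1"
        using that by (intro divide_left_mono) auto
      finally show ?thesis by simp
    qed
    then have "norm (\<Sum>k. ?z ^ Suc k / of_nat (Suc k)) \<le> (\<Sum>k. r ^ Suc k)"
      using that by (intro norm_suminf_le) (auto intro!: summable_mult summable_geometric)
    then show ?thesis
      using sums_unique[OF minus_Ln_one_minus_sums[of ?z]] norm_z that(2)
      unfolding G_def by (metis norm_minus_cancel)
  qed
  have int_G: "integrable M (G u r)" if "0 \<le> r" "r < 1" for u r
    by (rule integrable_const_bound[where B = "\<Sum>k. r ^ Suc k"]) (use that norm_G meas in auto)
  have bound: "\<bar>expectation (\<lambda>\<omega>. Im (G c r \<omega>) - Im (G a r \<omega>))\<bar> \<le> 2 * pi * \<bar>c - a\<bar> * (\<Sum>k. B k)"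
    if r: "0 \<le> r" "r < 1" for r
  proof -
    define T where "T u k = complex_of_real (r ^ Suc k / real (Suc k))
      * iexp (- (2 * pi * real (Suc k) * u)) * char (distr M borel Y) (2 * pi * real (Suc k))" for u k
    \<comment> \<open>Each series sums to minus the expected logarithm, which is why
      \<open>a\<close> and \<open>c\<close> change places.\<close>
    have "(\<lambda>k. T a k - T c k) sums (- expectation (G a r) - - expectation (G c r))"
      unfolding T_def G_def by (intro sums_diff expectation_Ln_one_minus_iexp_sums Y r)
    then have sums: "(\<lambda>k. T a k - T c k) sums expectation (\<lambda>\<omega>. G c r \<omega> - G a r \<omega>)"
      using int_G[OF r] by simp
    have le: "norm (T a k - T c k) \<le> 2 * pi * \<bar>c - a\<bar> * B k" for k
    proof -
      let ?e = "\<lambda>u. iexp (- (2 * pi * real (Suc k) * u))"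
      have "norm (T a k - T c k) = (r ^ Suc k / real (Suc k)) * norm (?e a - ?e c)
          * norm (char (distr M borel Y) (2 * pi * real (Suc k)))"
      proof -
        have "T a k - T c k = complex_of_real (r ^ Suc k / real (Suc k)) * (?e a - ?e c)
          * char (distr M borel Y) (2 * pi * real (Suc k))"
          by (simp only: T_def algebra_simps)
        then show ?thesis
          using r by (simp only: norm_mult norm_of_real abs_of_nonneg divide_nonneg_nonneg
              zero_le_power of_nat_0_le_iff)
      qed
      \<comment> \<open>The Lipschitz factor \<open>real (Suc k)\<close> cancels the denominator,
        and \<open>r ^ Suc k\<close> is bounded by 1, so the estimate is uniform in
        \<open>r\<close>.\<close>
      also have "\<dots> \<le> (1 / real (Suc k)) * (2 * pi * real (Suc k) * \<bar>c - a\<bar>) * B k"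
      proof (intro mult_mono B(2))
        show "r ^ Suc k / real (Suc k) \<le> 1 / real (Suc k)"
          using r by (intro divide_right_mono power_le_one) auto
        have "norm (?e a - ?e c) \<le> \<bar>2 * pi * real (Suc k) * (c - a)\<bar>"
          using norm_iexp_diff_le[of "- (2 * pi * real (Suc k) * a)" "- (2 * pi * real (Suc k) * c)"]
          by (simp only: right_diff_distrib)
        then show "norm (?e a - ?e c) \<le> 2 * pi * real (Suc k) * \<bar>c - a\<bar>"
          by (simp add: abs_mult del: of_nat_Suc)
      qed auto
      also have "\<dots> = 2 * pi * \<bar>c - a\<bar> * B k" by simp
      finally show ?thesis .
    qed
    have "summable (\<lambda>k. norm (T a k - T c k))"
      by (rule summable_comparison_test'[OF summable_mult[OF B(1), of "2 * pi * \<bar>c - a\<bar>"], of 0]) (use le in auto)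
    then have "norm (\<Sum>k. T a k - T c k) \<le> (\<Sum>k. 2 * pi * \<bar>c - a\<bar> * B k)"
      by (intro order_trans[OF summable_norm] suminf_le le summable_mult B)
    then have "norm (expectation (\<lambda>\<omega>. G c r \<omega> - G a r \<omega>)) \<le> 2 * pi * \<bar>c - a\<bar> * (\<Sum>k. B k)"
      using B(1) by (simp add: sums_unique[OF sums, symmetric] suminf_mult)
    moreover have "Im (expectation (\<lambda>\<omega>. G c r \<omega> - G a r \<omega>)) = expectation (\<lambda>\<omega>. Im (G c r \<omega>) - Im (G a r \<omega>))"
      using int_G[OF r] by simp
    ultimately show ?thesis
      using abs_Im_le_cmod order_trans by metis
  qed
  define R where "R n = real n / real (Suc n)" for n
  have R: "0 \<le> R n" "R n < 1" for n by (auto simp: R_def)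
  have R_lim: "R \<longlonglongrightarrow> 1"
    unfolding R_def by (rule LIMSEQ_n_over_Suc_n)
  have lim: "(\<lambda>n. Im (G u (R n) \<omega>)) \<longlonglongrightarrow> pi * (frac (Y \<omega> - u) - 1 / 2)" if "Y \<omega> - u \<notin> \<int>" for u \<omega>
  proof -
    \<comment> \<open>The real part is nonnegative, so the branch cut can be met only where the
      cosine is 1, that is, at integers. Elsewhere \<open>Ln\<close> is continuous up to
      \<open>r = 1\<close>.\<close>
    have "1 - iexp (2 * pi * (Y \<omega> - u)) \<notin> \<real>\<^sub>\<le>\<^sub>0"
    proof
      let ?z = "iexp (2 * pi * (Y \<omega> - u))"
      assume "1 - ?z \<in> \<real>\<^sub>\<le>\<^sub>0"
      then have *: "1 \<le> cos (2 * pi * (Y \<omega> - u))"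
        by (simp add: complex_nonpos_Reals_iff Re_exp del: of_real_mult of_real_diff)
      then have "cos (2 * pi * (Y \<omega> - u)) = 1" using cos_le_one order_antisym by blast
      then obtain j :: int where "2 * pi * (Y \<omega> - u) = j * 2 * pi"
        unfolding cos_one_2pi_int by auto
      then have "Y \<omega> - u = j" by simp
      then show False using that by simp
    qed
    then have "(\<lambda>n. Ln (1 - complex_of_real (R n) * iexp (2 * pi * (Y \<omega> - u))))
      \<longlonglongrightarrow> Ln (1 - complex_of_real 1 * iexp (2 * pi * (Y \<omega> - u)))"
      by (intro tendsto_intros R_lim) simp
    from tendsto_Im[OF this] show ?thesis
      using Im_Ln_one_minus_iexp[OF that] by (simp add: G_def)
  qed
  have "(\<lambda>n. expectation (\<lambda>\<omega>. Im (G c (R n) \<omega>) - Im (G a (R n) \<omega>)))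
    \<longlonglongrightarrow> expectation (\<lambda>\<omega>. pi * (frac (Y \<omega> - c) - 1 / 2) - pi * (frac (Y \<omega> - a) - 1 / 2))"
  proof (rule integral_dominated_convergence[where w = "\<lambda>_. 2 * pi"])
    show "(\<lambda>\<omega>. pi * (frac (Y \<omega> - c) - 1 / 2) - pi * (frac (Y \<omega> - a) - 1 / 2)) \<in> borel_measurable M"
      unfolding frac_def by measurable
    show "(\<lambda>\<omega>. Im (G c (R n) \<omega>) - Im (G a (R n) \<omega>)) \<in> borel_measurable M" for n
      using meas[OF R, measurable] by measurable
    show "AE \<omega> in M. (\<lambda>n. Im (G c (R n) \<omega>) - Im (G a (R n) \<omega>))
      \<longlonglongrightarrow> pi * (frac (Y \<omega> - c) - 1 / 2) - pi * (frac (Y \<omega> - a) - 1 / 2)"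
      using a c by eventually_elim (intro tendsto_diff lim)
    \<comment> \<open>Near integer values of \<open>Y \<omega> - u\<close> the logarithm itself is
      unbounded as \<open>r\<close> tends to 1, but its principal argument never exceeds
      \<open>pi\<close> in absolute value. This gives the dominating constant
      \<open>2 * pi\<close>.\<close>
    have Im_G: "\<bar>Im (G u (R n) \<omega>)\<bar> \<le> pi" for u n \<omega>
    proof -
      have "1 - complex_of_real (R n) * iexp (2 * pi * (Y \<omega> - u)) \<noteq> 0"
        using Re_pos[OF R] by (metis less_irrefl zero_complex.sel(1))
      then show ?thesis
        unfolding G_def using mpi_less_Im_Ln Im_Ln_le_pi by (smt (verit))
    qed
    have "norm (Im (G c (R n) \<omega>) - Im (G a (R n) \<omega>)) \<le> 2 * pi" for n \<omega>
      using Im_G[of c n \<omega>] Im_G[of a n \<omega>] unfolding real_norm_def by linarith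
    then show "AE \<omega> in M. norm (Im (G c (R n) \<omega>) - Im (G a (R n) \<omega>)) \<le> 2 * pi" for n
      by simp
  qed auto
  moreover have "expectation (\<lambda>\<omega>. pi * (frac (Y \<omega> - c) - 1 / 2) - pi * (frac (Y \<omega> - a) - 1 / 2))
    = pi * expectation (\<lambda>\<omega>. frac (Y \<omega> - c) - frac (Y \<omega> - a))"
    by (simp add: algebra_simps flip: integral_mult_right_zero)
  ultimately have "(\<lambda>n. \<bar>expectation (\<lambda>\<omega>. Im (G c (R n) \<omega>) - Im (G a (R n) \<omega>))\<bar>)
    \<longlonglongrightarrow> \<bar>pi * expectation (\<lambda>\<omega>. frac (Y \<omega> - c) - frac (Y \<omega> - a))\<bar>"
    by (intro tendsto_rabs) simp
  then have "\<bar>pi * expectation (\<lambda>\<omega>. frac (Y \<omega> - c) - frac (Y \<omega> - a))\<bar> \<le> 2 * pi * \<bar>c - a\<bar> * (\<Sum>k. B k)"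
    by (rule LIMSEQ_le_const2) (use bound R in auto)
  also have "\<dots> = pi * (2 * \<bar>c - a\<bar> * (\<Sum>k. B k))" by simp
  finally show ?thesis
    by (simp only: abs_mult abs_of_pos[OF pi_gt_zero] mult_le_cancel_left_pos[OF pi_gt_zero])
qed

section \<open>Base-\<open>b\<close> expansions and their integer prefixes\<close>

text \<open>Horner's scheme for \<open>digit_value b D n * b ^ n\<close>. Working with integers
  turns equality of digit strings into equality of numbers pinned between consecutive
  integers.\<close>

primrec prefix_num :: "nat \<Rightarrow> (nat \<Rightarrow> nat) \<Rightarrow> nat \<Rightarrow> nat" where
  "prefix_num b D 0 = D 0"
| "prefix_num b D (Suc n) = b * prefix_num b D n + D (Suc n)"

lemma digit_value_eq_prefix_num:
  assumes "b > 0"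
  shows "digit_value b D n = real (prefix_num b D n) / real b ^ n"
  using assms
  by (induction n)
     (simp_all add: digit_value_def power_int_minus power_int_def nat_add_distrib field_simps)

text \<open>Division by \<open>b\<close> with remainder peels off the last digit, because digits are
  below \<open>b\<close>.\<close>

lemma prefix_num_eq_iff:
  assumes "\<And>i. D i < b" "\<And>i. E i < b"
  shows "prefix_num b D n = prefix_num b E n \<longleftrightarrow> (\<forall>i\<le>n. D i = E i)"
proof (induction n)
  case (Suc n)
  have *: "prefix_num b F (Suc n) div b = prefix_num b F n" "prefix_num b F (Suc n) mod b = F (Suc n)"
    if "\<And>i. F i < b" for F
    using that[of "Suc n"] by auto
  have "prefix_num b D (Suc n) = prefix_num b E (Suc n) \<longleftrightarrow>
      prefix_num b D n = prefix_num b E n \<and> D (Suc n) = E (Suc n)"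
    using *[of D] *[of E] assms by (metis prefix_num.simps(2))
  then show ?case unfolding Suc.IH by (auto simp: le_Suc_eq)
qed auto

text \<open>Together the bounds identify the prefix as the floor of \<open>m * b ^ n\<close>. The
  tail beyond position \<open>n\<close> is compared with the tail made of digits
  \<open>b - 1\<close> only, whose value is \<open>1 / b ^ n\<close>.\<close>

lemma prefix_num_bounds:
  assumes b: "b \<ge> 2" and D: "\<And>i. D i < b" and inf: "infinite {i. D i \<noteq> b - 1}"
    and sums: "(\<lambda>i. real (D i) * real b powi (- int i)) sums m"
  shows "real (prefix_num b D n) \<le> m * real b ^ n" "m * real b ^ n < real (prefix_num b D n) + 1"
proof -
  let ?w = "\<lambda>i. real b powi (- int i)"
  let ?f = "\<lambda>i. real (D (i + Suc n)) * ?w (i + Suc n)"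
  have w_pos: "?w i > 0" for i using b by (simp add: zero_less_power_int)
  have "(\<Sum>i<Suc n. real (D i) * ?w i) = digit_value b D n"
    unfolding digit_value_def by (intro sum.cong) auto
  then have f: "?f sums (m - digit_value b D n)"
    using sums_split_initial_segment[OF sums, of "Suc n"] by (simp only:)
  have "0 \<le> m - digit_value b D n"
    by (rule sums_le[OF _ sums_zero f]) (use w_pos in \<open>auto simp: less_imp_le\<close>)
  then show "real (prefix_num b D n) \<le> m * real b ^ n"
    using b by (simp add: digit_value_eq_prefix_num field_simps)
  have "(\<lambda>i. (real b - 1) / real b ^ Suc n * (1 / real b) ^ i) sums
      ((real b - 1) / real b ^ Suc n * (1 / (1 - 1 / real b)))"
    using b by (intro sums_mult geometric_sums) auto
  also have "(\<lambda>i. (real b - 1) / real b ^ Suc n * (1 / real b) ^ i) = (\<lambda>i. (real b - 1) * ?w (i + Suc n))"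
    using b by (auto simp: fun_eq_iff power_int_minus power_int_def nat_add_distrib power_add field_simps)
  also have "(real b - 1) / real b ^ Suc n * (1 / (1 - 1 / real b)) = 1 / real b ^ n"
    using b by (simp add: field_simps)
  finally have diff: "(\<lambda>i. (real b - 1) * ?w (i + Suc n) - ?f i) sums (1 / real b ^ n - (m - digit_value b D n))"
    by (rule sums_diff[OF _ f])
  have D_le: "real (D i) \<le> real b - 1" for i
    using D[of i] b by linarith
  \<comment> \<open>One later digit different from \<open>b - 1\<close> makes the comparison of
    tails strict.\<close>
  obtain j where j: "Suc n \<le> j" "D j \<noteq> b - 1"
    using inf unfolding infinite_nat_iff_unbounded_le by auto
  then have "real (D j) < real b - 1"
    using D[of j] b by linarith
  then have "0 < (real b - 1) * ?w (j - Suc n + Suc n) - ?f (j - Suc n)"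
    using j(1) w_pos by simp
  then have "0 < (\<Sum>i. (real b - 1) * ?w (i + Suc n) - ?f i)"
    using D_le w_pos
    by (intro suminf_pos2[OF sums_summable[OF diff], of "j - Suc n"])
       (simp_all only: diff_ge_0_iff_ge mult_right_mono less_imp_le)
  then have "m < digit_value b D n + 1 / real b ^ n"
    using sums_unique[OF diff] by simp
  then show "m * real b ^ n < real (prefix_num b D n) + 1"
    using b by (simp add: digit_value_eq_prefix_num field_simps)
qed

text \<open>The digits are the last base-\<open>b\<close> digits of the floors of
  \<open>m * b ^ n\<close>, so the prefixes are these floors and, rescaled, converge to
  \<open>m\<close>.\<close>

lemma digit_expansion_exists:
  assumes b: "b \<ge> 2" and m: "0 \<le> m" "m < real b"
  shows "\<exists>D. (\<forall>i. D i < b) \<and> infinite {i. D i \<noteq> b - 1} \<and>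
           (\<lambda>i. real (D i) * real b powi (- int i)) sums m"
proof -
  define N where "N n = nat \<lfloor>m * real b ^ n\<rfloor>" for n
  define D where "D n = N n mod b" for n
  have N: "real (N n) \<le> m * real b ^ n" "m * real b ^ n < real (N n) + 1" for n
    using m unfolding N_def by (simp_all add: of_nat_nat) 
  have N_Suc: "N (Suc n) div b = N n" for n
  proof -
    have "\<lfloor>m * real b ^ n\<rfloor> = \<lfloor>m * real b ^ Suc n / real_of_int (int b)\<rfloor>"
      using b by simp
    also have "\<dots> = \<lfloor>m * real b ^ Suc n\<rfloor> div int b"
      by (rule floor_divide_real_eq_div) simp
    finally show ?thesis unfolding N_def by (simp add: nat_div_distrib')
  qed
  have prefix: "prefix_num b D n = N n" for n
  proof (induction n)
    case 0
    \<comment> \<open>Here \<open>m < b\<close> ensures that reduction modulo \<open>b\<close>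
      leaves the leading floor unchanged.\<close>
    have "N 0 < b" using N(1)[of 0] m by simp
    then show ?case by (simp add: D_def)
  next
    case (Suc n)
    then show ?case
      using N_Suc[of n] mult_div_mod_eq[of b "N (Suc n)"] by (simp add: D_def)
  qed
  have "(\<lambda>n. real (N n) / real b ^ n) \<longlonglongrightarrow> m"
  proof (rule tendsto_sandwich)
    have "(\<lambda>n. m - (1 / real b) ^ n) \<longlonglongrightarrow> m - 0"
      using b by (intro tendsto_diff tendsto_const LIMSEQ_power_zero) auto
    then show "(\<lambda>n. m - (1 / real b) ^ n) \<longlonglongrightarrow> m" by simp
    show "\<forall>\<^sub>F n in sequentially. m - (1 / real b) ^ n \<le> real (N n) / real b ^ n"
    proof (intro always_eventually allI)
      fix n
      have "m * real b ^ n - 1 \<le> real (N n)" using N(2)[of n] by simp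
      then have "(m * real b ^ n - 1) / real b ^ n \<le> real (N n) / real b ^ n"
        by (intro divide_right_mono) auto
      then show "m - (1 / real b) ^ n \<le> real (N n) / real b ^ n"
        using b by (simp add: diff_divide_distrib power_one_over)
    qed
    show "\<forall>\<^sub>F n in sequentially. real (N n) / real b ^ n \<le> m"
      using N(1) b by (intro always_eventually allI) (simp add: field_simps)
  qed simp
  then have "(\<lambda>n. digit_value b D n) \<longlonglongrightarrow> m"
    using b by (simp add: digit_value_eq_prefix_num prefix)
  then have "(\<lambda>i. real (D i) * real b powi (- int i)) sums m"
    by (simp add: sums_def_le digit_value_def atLeast0AtMost)
  moreover have "infinite {i. D i \<noteq> b - 1}"
  proof
    assume "finite {i. D i \<noteq> b - 1}"
    then obtain n where "\<forall>i\<in>{i. D i \<noteq> b - 1}. i < n"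
      using finite_nat_set_iff_bounded by auto
    then have n: "D i = b - 1" if "i \<ge> n" for i
      using that by force
    \<comment> \<open>If all digits from position \<open>n\<close> on were \<open>b - 1\<close>,
      each further digit would multiply \<open>N + 1\<close> by \<open>b\<close>.\<close>
    have step: "N (n + k) + 1 = b ^ k * (N n + 1)" for k
    proof (induction k)
      case (Suc k)
      have "N (n + Suc k) = b * N (n + k) + (b - 1)"
        using n[of "n + Suc k"] N_Suc[of "n + k"] mult_div_mod_eq[of b "N (n + Suc k)"]
        by (simp add: D_def)
      then have "N (n + Suc k) + 1 = b * (N (n + k) + 1)"
        using b by simp
      also have "\<dots> = b ^ Suc k * (N n + 1)" unfolding Suc.IH by (simp add: algebra_simps)
      finally show ?case .
    qed simp
    \<comment> \<open>The gap between \<open>m * b ^ n\<close> and the next integer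
      \<open>N n + 1\<close> is positive. It would grow by the factor \<open>b ^ k\<close>, although
      such a gap never exceeds 1.\<close>
    define \<epsilon> where "\<epsilon> = real (N n) + 1 - m * real b ^ n"
    have "\<epsilon> > 0" using N(2)[of n] by (simp add: \<epsilon>_def)
    obtain k where k: "1 / \<epsilon> < real b ^ k"
      using real_arch_pow[of "real b" "1 / \<epsilon>"] b by auto
    have "real (N (n + k)) + 1 = real b ^ k * (real (N n) + 1)"
      using arg_cong[OF step[of k], of real] by (simp add: algebra_simps)
    then have "real b ^ k * \<epsilon> = real (N (n + k)) + 1 - m * real b ^ (n + k)"
      by (simp add: \<epsilon>_def algebra_simps power_add)
    also have "\<dots> \<le> 1" using N(1)[of "n + k"] by simp
    finally show False using k \<open>\<epsilon> > 0\<close> by (simp add: field_simps)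
  qed
  moreover have "\<forall>i. D i < b" using b by (simp add: D_def)
  ultimately show ?thesis by blast
qed

text \<open>Unfolds the definite description once and for all. Uniqueness holds since two expansions
  of the same mantissa have, at every length, prefixes equal to the same floor.\<close>

lemma leading_digits_prefix:
  assumes b: "b \<ge> 2" and m: "0 \<le> base_mantissa b x" "base_mantissa b x < real b"
  shows leading_digits_less: "leading_digits b x i < b"
    and leading_digits_prefix_le:
      "real (prefix_num b (leading_digits b x) n) \<le> base_mantissa b x * real b ^ n"
    and less_leading_digits_prefix:
      "base_mantissa b x * real b ^ n < real (prefix_num b (leading_digits b x) n) + 1"
proof -
  let ?P = "\<lambda>D. (\<forall>i. D i \<in> {0..b - 1}) \<and> infinite {i. D i \<noteq> b - 1} \<and>
             (\<lambda>i. real (D i) * real b powi (- int i)) sums base_mantissa b x"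
  have in_iff: "k \<in> {0..b - 1} \<longleftrightarrow> k < b" for k using b by auto
  have "\<exists>!D. ?P D"
  proof (rule ex_ex1I)
    show "\<exists>D. ?P D" unfolding in_iff by (rule digit_expansion_exists[OF b m])
    fix D E assume "?P D" "?P E"
    then have lt: "\<And>i. D i < b" "\<And>i. E i < b" unfolding in_iff by blast+
    have "prefix_num b D n = prefix_num b E n" for n
    proof -
      have "real (prefix_num b D n) \<le> base_mantissa b x * real b ^ n"
        "base_mantissa b x * real b ^ n < real (prefix_num b D n) + 1"
        by (rule prefix_num_bounds[OF b]; use \<open>?P D\<close> lt in simp)+
      moreover have "real (prefix_num b E n) \<le> base_mantissa b x * real b ^ n"
        "base_mantissa b x * real b ^ n < real (prefix_num b E n) + 1"
        by (rule prefix_num_bounds[OF b]; use \<open>?P E\<close> lt in simp)+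
      ultimately show ?thesis by linarith
    qed
    then show "D = E" using prefix_num_eq_iff[of D b E, OF lt] by (auto simp: fun_eq_iff)
  qed
  then have P: "?P (leading_digits b x)"
    unfolding leading_digits_def by (rule theI')
  then have lt: "\<And>i. leading_digits b x i < b" unfolding in_iff by blast
  then show "leading_digits b x i < b" .
  show "real (prefix_num b (leading_digits b x) n) \<le> base_mantissa b x * real b ^ n"
    "base_mantissa b x * real b ^ n < real (prefix_num b (leading_digits b x) n) + 1"
    by (rule prefix_num_bounds[OF b]; use P lt in simp)+
qed

section \<open>Digit events as intervals for the fractional part\<close>

lemma base_mantissa_powr:
  assumes "b \<ge> 2"
  shows "base_mantissa b (real b powr y) = real b powr frac y"
  unfolding base_mantissa_def
proof (rule the_equality)
  have b: "1 < real b" using assms by simp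
  have "real b powr y = real b powr (frac y + real_of_int \<lfloor>y\<rfloor>)"
    by (simp add: frac_def)
  also have "\<dots> = real b powr frac y * real b powi \<lfloor>y\<rfloor>"
    using b by (simp only: powr_add) (simp add: powr_real_of_int')
  finally have "real b powr y = real b powr frac y * real b powi \<lfloor>y\<rfloor>" .
  moreover have "real b powr frac y < real b powr 1"
    using b frac_lt_1[of y] by (intro powr_less_mono) auto
  ultimately show "1 \<le> real b powr frac y \<and> real b powr frac y < real b \<and>
      (\<exists>z. real b powr y = real b powr frac y * real b powi z)"
    using b by (auto simp: ge_one_powr_ge_zero frac_ge_0)
  fix m assume "1 \<le> m \<and> m < real b \<and> (\<exists>z. real b powr y = m * real b powi z)"
  then obtain z where m: "1 \<le> m" "m < real b" and z: "real b powr y = m * real b powi z" by blast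
  have "real b powr (y - real_of_int z) = m"
    using z b by (simp add: powr_diff powr_real_of_int')
  \<comment> \<open>The bounds on the mantissa place \<open>y - z\<close> in \<open>[0, 1)\<close>,
    which forces \<open>z\<close> to be the floor of \<open>y\<close>.\<close>
  moreover from this have "log (real b) m = y - real_of_int z" using b by auto
  then have "0 \<le> y - real_of_int z" "y - real_of_int z < 1"
    using m b log_less_iff[of "real b" m 1] zero_le_log_cancel_iff[of "real b" m] by auto
  then have "\<lfloor>y\<rfloor> = z" by linarith
  ultimately show "m = real b powr frac y" by (simp add: frac_def)
qed

lemma digit_value_ge_1:
  assumes "d 0 \<ge> 1"
  shows "1 \<le> digit_value b d l"
proof -
  have "1 \<le> real (d 0)" using assms by simp
  also have "\<dots> \<le> digit_value b d l"
    unfolding digit_value_def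
    using member_le_sum[of 0 "{0..l}" "\<lambda>i. real (d i) * real b powi (- int i)"] by simp
  finally show ?thesis .
qed

text \<open>Keeps the right endpoint of the logarithmic interval at most 1. The left side does not
  increase with \<open>l\<close>: a further digit plus one unit in its place is at most one unit of
  the previous place.\<close>

lemma digit_value_le:
  assumes "\<And>i. d i < b"
  shows "digit_value b d l + real b powi (- int l) \<le> real b"
proof (induction l)
  case 0
  have "d 0 + 1 \<le> b" using assms[of 0] by simp
  then show ?case by (simp add: digit_value_def flip: of_nat_Suc)
next
  case (Suc l)
  have b: "0 < b" using assms[of 0] by simp
  have "d (Suc l) + 1 \<le> b" using assms[of "Suc l"] by simp
  then have "real (d (Suc l)) + 1 \<le> real b" by (simp flip: of_nat_Suc)
  then have "(real (d (Suc l)) + 1) * real b powi (- int (Suc l)) \<le> real b * real b powi (- int (Suc l))"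
    by (intro mult_right_mono) auto
  also have "\<dots> = real b powi (- int l)"
    using b by (simp add: power_int_minus power_int_def nat_add_distrib)
  finally show ?case
    using Suc.IH by (simp add: digit_value_def algebra_simps)
qed

lemma leading_digits_powr_eq_iff:
  assumes b: "b \<ge> 2" and d: "\<And>i. d i < b" and d0: "d 0 \<ge> 1"
  shows "(\<forall>i\<in>{0..l}. leading_digits b (real b powr y) i = d i) \<longleftrightarrow>
     log b (digit_value b d l) \<le> frac y \<and> frac y < log b (digit_value b d l + real b powi (- int l))"
proof -
  let ?D = "leading_digits b (real b powr y)" and ?m = "real b powr frac y"
  have b1: "1 < real b" using b by simp
  have "real b powr frac y < real b powr 1"
    using b1 frac_lt_1[of y] by (intro powr_less_mono) auto
  then have m: "0 \<le> base_mantissa b (real b powr y)" "base_mantissa b (real b powr y) < real b"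
    using b1 by (simp_all add: base_mantissa_powr[OF b])
  have v: "1 \<le> digit_value b d l" by (rule digit_value_ge_1[of d, OF d0])
  have "(\<forall>i\<in>{0..l}. ?D i = d i) \<longleftrightarrow> prefix_num b ?D l = prefix_num b d l"
    using prefix_num_eq_iff[of ?D b d l] leading_digits_less[OF b m] d by auto
  also have "\<dots> \<longleftrightarrow> real (prefix_num b d l) \<le> ?m * real b ^ l \<and> ?m * real b ^ l < real (prefix_num b d l) + 1"
  proof -
    have "real (prefix_num b ?D l) \<le> ?m * real b ^ l" "?m * real b ^ l < real (prefix_num b ?D l) + 1"
      using leading_digits_prefix_le[OF b m] less_leading_digits_prefix[OF b m]
      by (simp_all add: base_mantissa_powr[OF b])
    \<comment> \<open>Distinct integers have disjoint unit intervals \<open>[N, N + 1)\<close>, so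
      the one containing \<open>?m * b ^ l\<close> determines the prefix.\<close>
    then show ?thesis by (cases "prefix_num b ?D l" "prefix_num b d l" rule: linorder_cases) auto
  qed
  also have "\<dots> \<longleftrightarrow> digit_value b d l \<le> ?m \<and> ?m < digit_value b d l + real b powi (- int l)"
    using b by (simp add: digit_value_eq_prefix_num power_int_minus power_int_def field_simps)
  also have "\<dots> \<longleftrightarrow> log b (digit_value b d l) \<le> frac y \<and> frac y < log b (digit_value b d l + real b powi (- int l))"
  proof -
    have "0 < real b powi (- int l)" using b1 by (intro zero_less_power_int) simp
    then have "0 < digit_value b d l + real b powi (- int l)" using v by linarith
    then show ?thesis using v b1 by (simp add: log_le_iff less_log_iff)
  qed
  finally show ?thesis .
qed

section \<open>Estimates for normal variables and comparison with \<open>h\<close>\<close>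

text \<open>Standardizing \<open>Y\<close> separates the mean into a phase of modulus 1, so only
  \<open>\<sigma>\<close> survives in the norm.\<close>

lemma (in prob_space) norm_char_normal:
  assumes Y: "distributed M lborel Y (normal_density \<mu> \<sigma>)" and "\<sigma> > 0"
  shows "norm (char (distr M borel Y) t) = exp (- (\<sigma> * t)\<^sup>2 / 2)"
proof -
  define Z where "Z \<omega> = (Y \<omega> - \<mu>) / \<sigma>" for \<omega>
  have Z: "distributed M lborel Z std_normal_density"
    using normal_standard_normal_convert[OF \<open>\<sigma> > 0\<close>, of Y \<mu>] Y by (simp add: Z_def[abs_def])
  then have [measurable]: "Z \<in> borel_measurable M"
    using distributed_real_measurable[OF _ Z] by (simp add: distributed_def)
  have char_Z: "char (distr M borel Z) s = exp (- s\<^sup>2 / 2)" for s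
  proof -
    have "distr M borel Z = std_normal_distribution"
      using distributed_distr_eq_density[OF Z] by (simp cong: distr_cong)
    then show ?thesis by (simp add: char_std_normal_distribution)
  qed
  have Y_eq: "Y = (\<lambda>\<omega>. \<mu> + \<sigma> * Z \<omega>)"
    using \<open>\<sigma> > 0\<close> by (simp add: Z_def)
  have "char (distr M borel Y) t = expectation (\<lambda>\<omega>. iexp (t * \<mu>) * iexp (\<sigma> * t * Z \<omega>))"
    unfolding char_def Y_eq by (subst integral_distr) (auto simp: algebra_simps exp_add)
  also have "\<dots> = iexp (t * \<mu>) * char (distr M borel Z) (\<sigma> * t)"
    unfolding char_def by (subst integral_distr) (simp_all del: of_real_mult)
  finally show ?thesis
    by (simp add: norm_mult char_Z del: of_real_mult)
qed

text \<open>A distribution with a density ignores countable sets. This removes the jumps of the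
  sawtooth, where the limit of the Fourier series is not established.\<close>

lemma (in prob_space) AE_diff_not_Ints:
  fixes Y :: "'a \<Rightarrow> real"
  assumes "distributed M lborel Y f"
  shows "AE \<omega> in M. Y \<omega> - u \<notin> \<int>"
proof -
  have "countable ((\<lambda>z. u + z) ` (\<int> :: real set))"
    by (simp add: Ints_def)
  then have "AE x in lborel. x \<notin> (\<lambda>z. u + z) ` \<int>"
    by (intro AE_not_in countable_imp_null_set_lborel)
  then have ae: "AE x in lborel. x - u \<notin> \<int>"
    by eventually_elim (auto simp: image_iff)
  have [measurable]: "Y \<in> measurable M lborel" "f \<in> borel_measurable lborel"
    using assms by (auto simp: distributed_def)
  have "AE x in density lborel f. x - u \<notin> \<int>"
    using ae by (subst AE_density) auto
  then have "AE x in distr M lborel Y. x - u \<notin> \<int>"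
    unfolding distributed_distr_eq_density[OF assms] .
  then show ?thesis by (rule AE_distrD[rotated]) measurable
qed

text \<open>The single term \<open>m ^ m / m!\<close> of the exponential series is at most
  \<open>exp m\<close>; inverting and taking square roots gives the claim.\<close>

lemma exp_minus_half_le_h: "exp (- (real m / 2)) \<le> h m"
proof -
  have "real m ^ m / fact m \<le> exp (real m)"
    using sum_le_suminf[OF summable_exp_generic, of "{m}" "real m"]
    by (simp add: exp_def divide_inverse mult.commute)
  then have "exp (- real m) \<le> fact m / real m ^ m"
    by (cases "m = 0") (simp_all add: exp_minus field_simps)
  then have "sqrt (exp (- real m)) \<le> h m"
    unfolding h_def by (rule real_sqrt_le_mono)
  moreover have "exp (- real m) = (exp (- (real m / 2)))\<^sup>2"
    by (simp flip: exp_double)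
  ultimately show ?thesis by simp
qed

text \<open>As functions of \<open>y\<close>, both sawtooth terms have slope 1 between jumps, so
  their difference is a step function that changes only where \<open>frac y\<close> passes
  \<open>a\<close>, \<open>c\<close> or wraps around.\<close>

lemma indicator_frac_eq:
  assumes "0 \<le> a" "a \<le> c" "c \<le> 1"
  shows "(if a \<le> frac y \<and> frac y < c then 1 else 0 :: real) = c - a + (frac (y - c) - frac (y - a))"
proof -
  have frac_diff: "frac (y - u) = (if u \<le> frac y then frac y - u else frac y - u + 1)"
    if "0 \<le> u" "u \<le> 1" for u
  proof -
    have "\<lfloor>y - u\<rfloor> = (if u \<le> frac y then \<lfloor>y\<rfloor> else \<lfloor>y\<rfloor> - 1)"
      using that frac_ge_0[of y] frac_lt_1[of y] unfolding frac_def
      by (cases "u \<le> y - of_int \<lfloor>y\<rfloor>") (simp_all only: if_True if_False, (rule floor_unique; simp; linarith)+)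
    then show ?thesis by (simp add: frac_def)
  qed
  show ?thesis
    using assms frac_diff[of a] frac_diff[of c] by auto
qed

lemma (in prob_space) prob_frac_normal_bound:
  assumes Y: "distributed M lborel Y (normal_density \<mu> \<sigma>)" and \<sigma>: "\<sigma> \<ge> 1 / 6"
    and ac: "0 \<le> a" "a \<le> c" "c \<le> 1"
  shows "\<bar>prob {\<omega> \<in> space M. a \<le> frac (Y \<omega>) \<and> frac (Y \<omega>) < c} - (c - a)\<bar>
    \<le> (c - a) * (3 * exp (- 18 * \<sigma>\<^sup>2))"
proof -
  have Y_meas[measurable]: "Y \<in> borel_measurable M"
    using Y by (auto simp: distributed_def)
  have [measurable]: "(\<lambda>\<omega>. frac (Y \<omega> - u)) \<in> borel_measurable M" for u
    unfolding frac_def by measurable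
  have int: "integrable M (\<lambda>\<omega>. frac (Y \<omega> - u))" for u
    by (rule integrable_const_bound[where B = 1]) (auto simp: frac_ge_0 frac_lt_1 less_imp_le)
  define p where "p = exp (- 18 * \<sigma>\<^sup>2)"
  define B where "B k = p * (p ^ 3) ^ k" for k
  have \<sigma>2: "1 / 36 \<le> \<sigma>\<^sup>2"
    using power_mono[OF \<sigma>, of 2] by (simp add: power2_eq_square)
  have "0 < p" by (simp add: p_def)
  \<comment> \<open>The assumption \<open>\<sigma> \<ge> 1 / 6\<close> enters here:
    \<open>54 / 36 = 3 / 2\<close>, and \<open>exp (3 / 2)\<close> is at least
    \<open>1 + 3 / 2 + 9 / 8 > 3\<close>.\<close>
  have p3: "p ^ 3 \<le> 1 / 3"
  proof -
    have "p ^ 3 = exp (- (54 * \<sigma>\<^sup>2))"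
      unfolding p_def exp_of_nat_mult[symmetric] by simp
    also have "\<dots> \<le> exp (- (3 / 2))" using \<sigma>2 by simp
    also have "\<dots> \<le> 1 / 3"
      using exp_lower_Taylor_quadratic[of "3 / 2 :: real"]
      by (simp add: exp_minus power2_eq_square field_simps)
    finally show ?thesis .
  qed
  have sums: "B sums (p * (1 / (1 - p ^ 3)))"
    unfolding B_def using p3 \<open>0 < p\<close> by (intro sums_mult geometric_sums) simp
  have char_le: "norm (char (distr M borel Y) (2 * pi * real (Suc k))) \<le> B k" for k
  proof -
    \<comment> \<open>A linear minorant of the square, exact for \<open>k = 0\<close> and
      \<open>k = 1\<close>, replaces the theta-like series by a geometric one with ratio
      \<open>p ^ 3\<close>.\<close>
    have "3 * k + 1 \<le> (Suc k)\<^sup>2"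
      by (cases k) (simp_all add: power2_eq_square algebra_simps)
    then have "real (3 * k + 1) \<le> real ((Suc k)\<^sup>2)"
      by (simp only: of_nat_le_iff)
    then have "3 * real k + 1 \<le> (real (Suc k))\<^sup>2"
      by (simp only: of_nat_add of_nat_mult of_nat_power of_nat_numeral of_nat_1)
    then have "18 * \<sigma>\<^sup>2 * (3 * real k + 1) \<le> 18 * \<sigma>\<^sup>2 * (real (Suc k))\<^sup>2"
      by (intro mult_left_mono) auto
    also have "\<dots> \<le> 2 * pi\<^sup>2 * (\<sigma>\<^sup>2 * (real (Suc k))\<^sup>2)"
    proof -
      \<comment> \<open>Replacing \<open>pi\<close> by 3 turns the constant
        \<open>2 * pi\<^sup>2\<close> into 18.\<close>
      have "3\<^sup>2 \<le> pi\<^sup>2" using pi_gt3 by (intro power_mono) auto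
      then have "18 * (\<sigma>\<^sup>2 * (real (Suc k))\<^sup>2) \<le> 2 * pi\<^sup>2 * (\<sigma>\<^sup>2 * (real (Suc k))\<^sup>2)"
        by (intro mult_right_mono) auto
      then show ?thesis by (simp only: mult.assoc)
    qed
    finally have "- (\<sigma> * (2 * pi * real (Suc k)))\<^sup>2 / 2 \<le> - 18 * \<sigma>\<^sup>2 * (3 * real k + 1)"
      by (simp add: power_mult_distrib mult_ac del: of_nat_Suc)
    then have "norm (char (distr M borel Y) (2 * pi * real (Suc k))) \<le> exp (- 18 * \<sigma>\<^sup>2 * (3 * real k + 1))"
      using \<sigma> by (simp add: norm_char_normal[OF Y])
    also have "\<dots> = B k"
      unfolding B_def p_def exp_of_nat_mult[symmetric] exp_add[symmetric]
      by (simp add: algebra_simps)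
    finally show ?thesis .
  qed
  have "prob {\<omega> \<in> space M. a \<le> frac (Y \<omega>) \<and> frac (Y \<omega>) < c}
      = expectation (indicator {\<omega> \<in> space M. a \<le> frac (Y \<omega>) \<and> frac (Y \<omega>) < c})"
    by (simp add: Int_absorb2)
  also have "\<dots> = expectation (\<lambda>\<omega>. c - a + (frac (Y \<omega> - c) - frac (Y \<omega> - a)))"
    by (intro Bochner_Integration.integral_cong)
       (auto simp: indicator_def simp flip: indicator_frac_eq[OF ac])
  also have "\<dots> = c - a + expectation (\<lambda>\<omega>. frac (Y \<omega> - c) - frac (Y \<omega> - a))"
    using int by (simp add: prob_space)
  finally have "\<bar>prob {\<omega> \<in> space M. a \<le> frac (Y \<omega>) \<and> frac (Y \<omega>) < c} - (c - a)\<bar>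
      = \<bar>expectation (\<lambda>\<omega>. frac (Y \<omega> - c) - frac (Y \<omega> - a))\<bar>" by simp
  also have "\<dots> \<le> 2 * \<bar>c - a\<bar> * (\<Sum>k. B k)"
    by (rule expectation_frac_diff_le[OF Y_meas AE_diff_not_Ints[OF Y] AE_diff_not_Ints[OF Y]
          sums_summable[OF sums] char_le])
  also have "\<dots> = (c - a) * (2 * p * (1 / (1 - p ^ 3)))"
    using ac by (simp add: sums_unique[OF sums, symmetric])
  also have "\<dots> \<le> (c - a) * (3 * p)"
  proof (intro mult_left_mono)
    \<comment> \<open>With ratio at most \<open>1 / 3\<close> the geometric sum is at most
      \<open>3 / 2\<close> times its first term; doubled, this is the constant 3.\<close>
    have "1 / (1 - p ^ 3) \<le> 3 / 2" using p3 by (simp add: divide_le_eq)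
    then have "2 * p * (1 / (1 - p ^ 3)) \<le> 2 * p * (3 / 2)"
      using \<open>0 < p\<close> by (intro mult_left_mono) auto
    then show "2 * p * (1 / (1 - p ^ 3)) \<le> 3 * p" by simp
  qed (use ac in auto)
  finally show ?thesis by (simp add: p_def)
qed

theorem corollary7:
  fixes M :: "'a measure" and X Y :: "'a \<Rightarrow> real" and \<mu> \<sigma> :: real
    and b l :: nat and d :: "nat \<Rightarrow> nat"
  assumes "b \<ge> 2"
    and "prob_space M"
    and "distributed M lborel Y (normal_density \<mu> \<sigma>)"
    and "\<sigma> \<ge> 1 / 6"
    and "\<And>\<omega>. \<omega> \<in> space M \<Longrightarrow> X \<omega> = real b powr Y \<omega>"
    and "\<And>i. d i \<in> {0..b - 1}"
    and "d 0 \<ge> 1"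
  shows "\<bar>measure M {\<omega> \<in> space M. \<forall>i\<in>{0..l}. leading_digits b (X \<omega>) i = d i}
            / log (real b) (1 + real b powi (- int l) / digit_value b d l) - 1\<bar>
         \<le> 3 * h (nat \<lfloor>36 * \<sigma>\<^sup>2\<rfloor>)"
proof -
  interpret prob_space M by fact
  let ?v = "digit_value b d l" and ?w = "real b powi (- int l)"
  define a where "a = log b ?v"
  define c where "c = log b (?v + ?w)"
  have b: "1 < real b" using assms(1) by simp
  have d: "d i < b" for i using assms(1) assms(6)[of i] by auto
  have v: "1 \<le> ?v" by (rule digit_value_ge_1) fact
  have v_le: "?v + ?w \<le> real b" using d by (rule digit_value_le)
  have w: "0 < ?w" using b by (intro zero_less_power_int) simp
  have ac: "0 \<le> a" "a < c" "c \<le> 1"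
    unfolding a_def c_def using b v w v_le by (auto simp: log_le_one_cancel_iff)
  have delta: "log b (1 + ?w / ?v) = c - a"
  proof -
    \<comment> \<open>The Benford probability is thus the length of the interval
      \<open>[a, c)\<close>, and the relative error is the absolute error divided by that
      length.\<close>
    have "1 + ?w / ?v = (?v + ?w) / ?v" using v by (simp add: field_simps)
    moreover have "0 < ?v + ?w" using v w by linarith
    ultimately show ?thesis
      unfolding a_def c_def using b v by (simp add: log_divide)
  qed
  have event: "{\<omega> \<in> space M. \<forall>i\<in>{0..l}. leading_digits b (X \<omega>) i = d i}
      = {\<omega> \<in> space M. a \<le> frac (Y \<omega>) \<and> frac (Y \<omega>) < c}"
    unfolding a_def c_def
    by (intro Collect_cong conj_cong refl)
       (simp only: assms(5) leading_digits_powr_eq_iff[of b d, OF assms(1) d assms(7)])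
  have "\<bar>measure M {\<omega> \<in> space M. \<forall>i\<in>{0..l}. leading_digits b (X \<omega>) i = d i}
            / log (real b) (1 + ?w / ?v) - 1\<bar>
      = \<bar>prob {\<omega> \<in> space M. a \<le> frac (Y \<omega>) \<and> frac (Y \<omega>) < c} - (c - a)\<bar> / (c - a)"
  proof -
    have "p / (c - a) - 1 = (p - (c - a)) / (c - a)" for p
      using ac by (simp add: diff_divide_distrib)
    moreover have "\<bar>c - a\<bar> = c - a" using ac by simp
    ultimately show ?thesis
      by (simp only: delta abs_divide event)
  qed
  also have "\<dots> \<le> 3 * exp (- 18 * \<sigma>\<^sup>2)"
    using prob_frac_normal_bound[OF assms(3,4) ac(1) less_imp_le[OF ac(2)] ac(3)] ac
    by (simp add: divide_le_eq mult.commute)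
  also have "\<dots> \<le> 3 * h (nat \<lfloor>36 * \<sigma>\<^sup>2\<rfloor>)"
  proof -
    \<comment> \<open>Half of the floor is at most \<open>18 * \<sigma>\<^sup>2\<close>, so rounding
      down only enlarges the exponential bound.\<close>
    have "real (nat \<lfloor>36 * \<sigma>\<^sup>2\<rfloor>) \<le> 36 * \<sigma>\<^sup>2" by (simp add: of_nat_nat)
    then have "exp (- 18 * \<sigma>\<^sup>2) \<le> exp (- (real (nat \<lfloor>36 * \<sigma>\<^sup>2\<rfloor>) / 2))" by simp
    then show ?thesis using exp_minus_half_le_h order_trans by (smt (verit))
  qed
  finally show ?thesis .
qed

end
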